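(* For a finite digraph $G$, the poset $\operatorname{Path}(G)$ of all directed paths in $G$ under the subpath ordering is atomic if and only if at least one of the following conditions holds: (i) $G$ is strongly connected; or (ii) $G$ is a bicycle.
   Context: A digraph is a set $G$ of vertices with a binary relation $E(G)\subseteq G\times G$ (loops allowed); $u\to v$ means $(u,v)\in E(G)$. A path is a sequence $v_1\to v_2\to\dots\to v_k$ ($k\ge1$) of vertices with $v_i\to v_{i+1}$ for all $i$ (vertices may repeat; its length is $k-1$; paths of length $0$ are allowed and are distinct from loops). It is simple if all its vertices are distinct; it is a cycle if $k\ge2$ and $v_1=v_k$, and a simple cycle if moreover $v_1,\dots,v_{k-1}$ are distinct. A subpath of $v_1\to\dots\to v_k$ is a path $v_i\to v_{i+1}\to\dots\to v_j$ with $1\le i\le j\le k$; this defines the subpath ordering on the set $\operatorname{Path}(G)$ of all paths in $G$. $G$ is strongly connected if it has only one strongly connected component, i.e. for any two vertices $u,v$ there is a path from $u$ to $v$ and a path from $v$ to $u$. A bicycle is a digraph consisting precisely of two vertex-disjoint simple cycles $\pi_1$ (initial cycle) and $\pi_2$ (terminal cycle), connected by a simple directed path $\tau$ (connecting path) from a vertex of $\pi_1$ to a vertex of $\pi_2$, no internal vertex of which belongs to $\pi_1$ or $\pi_2$. Either or both of $\pi_1,\pi_2$ are allowed to be absent (so a simple path, or a simple cycle with a simple path leading into it or out of it and otherwise disjoint from it, are bicycles), and a single simple cycle is also a bicycle; but if both cycles are present they share no vertex, so $\tau$ is non-trivial. A poset which is downward closed in itself is atomic if it is not the union of two proper downward closed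 subsets; equivalently (joint embedding property) for all $x,y$ in it there is $z$ in it with $x\le z$ and $y\le z$. *)

theory Defs
  imports
    "Graph_Theory.Graph_Theory"
    "HOL-Library.Sublist"
begin

(* Paths of the paper are the library's vertex walks: nonempty lists of vertices, repetitions
   allowed, consecutive vertices joined by an arc.  The subpath ordering is sublist (contiguous). *)
definition Path :: "'a pair_pre_digraph \<Rightarrow> 'a list set" where
  "Path G = {p. vwalk p (with_proj G)}"

definition simple_path :: "'a pair_pre_digraph \<Rightarrow> 'a list \<Rightarrow> bool" where
  "simple_path G p \<longleftrightarrow> p \<in> Path G \<and> distinct p"

(* A cycle repeats its first vertex at the end, so a loop at v is the cycle [v, v]. *)
definition simple_cycle :: "'a pair_pre_digraph \<Rightarrow> 'a list \<Rightarrow> bool" where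
  "simple_cycle G c \<longleftrightarrow> c \<in> Path G \<and> 2 \<le> length c \<and> hd c = last c \<and> distinct (butlast c)"

(* The library's strongly_connected additionally demands a vertex; here the empty digraph,
   whose path poset is (vacuously) atomic, counts as strongly connected. *)
definition strongly_conn :: "'a pair_pre_digraph \<Rightarrow> bool" where
  "strongly_conn G \<longleftrightarrow>
     (\<forall>u\<in>pverts G. \<forall>v\<in>pverts G. \<exists>p\<in>Path G. hd p = u \<and> last p = v)"

(* c1, t, c2 are the initial cycle, connecting path and terminal cycle; the empty list stands for
   an absent cycle.  The path t meets a cycle that is present in just the one endpoint of t; if both
   are present, disjointness forces t to be non-trivial.  A single simple cycle is
   the case where one cycle is absent and t has length 0. *)
definition bicycle :: "'a pair_pre_digraph \<Rightarrow> bool" where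
  "bicycle G \<longleftrightarrow> (\<exists>c1 t c2.
     (c1 = [] \<or> simple_cycle G c1) \<and>
     simple_path G t \<and>
     (c2 = [] \<or> simple_cycle G c2) \<and>
     set c1 \<inter> set c2 = {} \<and>
     (c1 \<noteq> [] \<longrightarrow> set t \<inter> set c1 = {hd t}) \<and>
     (c2 \<noteq> [] \<longrightarrow> set t \<inter> set c2 = {last t}) \<and>
     pverts G = set c1 \<union> set t \<union> set c2 \<and>
     parcs G = set (vwalk_arcs c1) \<union> set (vwalk_arcs t) \<union> set (vwalk_arcs c2))"

definition down_closed_in :: "'p set \<Rightarrow> ('p \<Rightarrow> 'p \<Rightarrow> bool) \<Rightarrow> 'p set \<Rightarrow> bool" where
  "down_closed_in P le A \<longleftrightarrow> A \<subseteq> P \<and> (\<forall>y\<in>A. \<forall>x\<in>P. le x y \<longrightarrow> x \<in> A)"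

definition atomic_poset :: "'p set \<Rightarrow> ('p \<Rightarrow> 'p \<Rightarrow> bool) \<Rightarrow> bool" where
  "atomic_poset P le \<longleftrightarrow>
     \<not> (\<exists>A B. down_closed_in P le A \<and> down_closed_in P le B \<and> A \<noteq> P \<and> B \<noteq> P \<and> P = A \<union> B)"

lemma atomic_poset_iff_joint_embedding:
  assumes refl: "\<And>x. x \<in> P \<Longrightarrow> le x x"
    and trans: "\<And>x y z. \<lbrakk>x \<in> P; y \<in> P; z \<in> P; le x y; le y z\<rbrakk> \<Longrightarrow> le x z"
  shows "atomic_poset P le \<longleftrightarrow> (\<forall>x\<in>P. \<forall>y\<in>P. \<exists>z\<in>P. le x z \<and> le y z)"
proof
  assume at: "atomic_poset P le"
  show "\<forall>x\<in>P. \<forall>y\<in>P. \<exists>z\<in>P. le x z \<and> le y z"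
  proof (intro ballI, rule ccontr)
    fix x y assume xy: "x \<in> P" "y \<in> P" and no: "\<not> (\<exists>z\<in>P. le x z \<and> le y z)"
    let ?A = "{p \<in> P. \<not> le x p}" and ?B = "{p \<in> P. \<not> le y p}"
    have "down_closed_in P le ?A" "down_closed_in P le ?B"
      unfolding down_closed_in_def using trans xy by blast+
    moreover have "?A \<noteq> P" "?B \<noteq> P" using refl xy by blast+
    moreover have "P = ?A \<union> ?B" using no by blast
    ultimately show False using at unfolding atomic_poset_def by blast
  qed
next
  assume "\<forall>x\<in>P. \<forall>y\<in>P. \<exists>z\<in>P. le x z \<and> le y z"
  then show "atomic_poset P le"
    unfolding atomic_poset_def down_closed_in_def by (smt (verit) UnE Un_upper1 subset_antisym subsetI)
qed

lemma (in pair_wf_digraph) strongly_connected_iff_strongly_conn: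
  "strongly_connected (with_proj G) \<longleftrightarrow> pverts G \<noteq> {} \<and> strongly_conn G"
  by (auto simp: strongly_connected_def strongly_conn_def Path_def reachable_vwalk_conv)

end

theory Submission
  imports Defs
begin

text \<open>
  By the joint embedding property, atomicity says that any two paths are subpaths of a common path.
  In a strongly connected digraph two paths can always be concatenated through a third one. All the
  work concerns a digraph that is not strongly connected, where both atomicity and being a bicycle
  turn out to mean that the digraph has a \<^emph>\<open>bottleneck\<close>: an arc \<open>u \<rightarrow> v\<close> such that every vertex
  either reaches \<open>u\<close> or is reached from \<open>v\<close>, the arc is the only passage from the first kind to
  the second and admits no return, walking forwards from \<open>v\<close> never offers a choice, and neither
  does walking backwards from \<open>u\<close>.

  Suppose any two paths embed jointly. If \<open>x\<close> is unreachable from \<open>y\<close>, then a path containing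
  both leads from \<open>x\<close> to \<open>y\<close>, and one of its arcs \<open>u \<rightarrow> v\<close> cannot be undone. A path uses such an
  arc at most once, so two paths that both start with it and sit inside a common path start there
  at the same place; hence one is a prefix of the other and there is no branching after \<open>v\<close>
  (\<open>joint_embedding_deterministic\<close>). Embedding the arc together with a vertex or another arc gives
  the remaining conditions (\<open>joint_embedding_imp_bottleneck\<close>). Conversely, with a bottleneck every
  path extends to one crossing \<open>u \<rightarrow> v\<close>, and among the crossing paths the parts after the arc are
  comparable as prefixes and the parts before it as suffixes, so the longer of each make a common
  extension (\<open>bottleneck_imp_joint_embedding\<close>).

  A finite region in which walking from \<open>v\<close> never offers a choice is a path that stops or runs into
  a cycle, here called a \<^emph>\<open>lasso\<close> (\<open>deterministic_lasso_exists\<close>). The forward lasso of \<open>v\<close> and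
  the backward lasso of \<open>u\<close>, joined by the arc, are a bicycle. Conversely, the first arc of the
  connecting path of a bicycle is a bottleneck as soon as that path has an arc, and otherwise the
  bicycle is strongly connected. Reversing all arcs exchanges the two sides of a bottleneck, so the
  results on determinism and lassos are proved for the side after the arc and used for both.
\<close>

section \<open>Paths and reachability\<close>

text \<open>
  This form shows at once how the arcs behave under reversal and what their ends are.
\<close>

lemma in_set_vwalk_arcs_iff:
  "(x, y) \<in> set (vwalk_arcs p) \<longleftrightarrow> (\<exists>a b. p = a @ x # y # b)"
proof (induction p rule: vwalk_arcs.induct)
  case (3 w z p)
  then show ?case by (auto simp: Cons_eq_append_conv)
qed (auto simp: Cons_eq_append_conv)

lemma set_vwalk_arcs_rev: "set (vwalk_arcs (rev p)) = (set (vwalk_arcs p))\<inverse>"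
proof -
  have "(x, y) \<in> set (vwalk_arcs p) \<Longrightarrow> (y, x) \<in> set (vwalk_arcs (rev p))" for x y p
    unfolding in_set_vwalk_arcs_iff by force
  from this[of _ _ p] this[of _ _ "rev p"] show ?thesis by auto
qed

lemma source_of_vwalk_arc:
  assumes "(x, y) \<in> set (vwalk_arcs p)" shows "x \<in> set (butlast p)"
proof -
  from assms obtain a b where "p = a @ x # y # b" by (auto simp: in_set_vwalk_arcs_iff)
  then show ?thesis by (simp add: butlast_append)
qed

lemma vwalk_arc_ends:
  assumes "(x, y) \<in> set (vwalk_arcs p)" shows "x \<in> set p" "y \<in> set p"
  using assms by (auto simp: in_set_vwalk_arcs_iff)

lemma vertex_has_vwalk_arc:
  assumes "x \<in> set (butlast p)" shows "\<exists>y. (x, y) \<in> set (vwalk_arcs p)"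
proof -
  from assms have "p \<noteq> []" by auto
  with assms obtain a b where "p = (a @ x # b) @ [last p]"
    by (metis append_butlast_last_id split_list)
  then have "p = a @ x # hd (b @ [last p]) # tl (b @ [last p])"
    by (cases b) auto
  then show ?thesis unfolding in_set_vwalk_arcs_iff by blast
qed

text \<open>
  Only the last entry may repeat an earlier one, since no arc starts there; the lemma thus serves
  simple paths and simple cycles alike.
\<close>

lemma vwalk_arcs_unique_successor:
  assumes "distinct (butlast p)" "(x, y) \<in> set (vwalk_arcs p)" "(x, z) \<in> set (vwalk_arcs p)"
  shows "y = z"
proof -
  from assms(2) obtain a b where p1: "p = a @ x # y # b" unfolding in_set_vwalk_arcs_iff by blast
  from assms(3) obtain c d where p2: "p = c @ x # z # d" unfolding in_set_vwalk_arcs_iff by blast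
  have "butlast (r @ x # w # s) = r @ x # butlast (w # s)" for r s and w :: 'a
    by (simp add: butlast_append)
  then have "butlast p = a @ x # butlast (y # b)" "butlast p = c @ x # butlast (z # d)"
    using p1 p2 by metis+
  with assms(1) have "a = c"
    by (metis append_Cons_eq_iff distinct.simps(2) distinct_append not_distinct_conv_prefix)
  with p1 p2 show ?thesis by simp
qed

lemma Path_iff:
  "p \<in> Path G \<longleftrightarrow> p \<noteq> [] \<and> set p \<subseteq> pverts G \<and> set (vwalk_arcs p) \<subseteq> parcs G"
  by (auto simp: Path_def vwalk_def)

lemma Path_append_iff:
  assumes "p \<noteq> []" "q \<noteq> []"
  shows "p @ q \<in> Path G \<longleftrightarrow> p \<in> Path G \<and> q \<in> Path G \<and> (last p, hd q) \<in> parcs G"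
  using assms by (auto simp: Path_iff vwalk_arcs_append)

lemma Path_sublist:
  assumes "q \<in> Path G" "sublist p q" "p \<noteq> []" shows "p \<in> Path G"
proof -
  from assms(2) obtain a b where q: "q = a @ p @ b" by (auto simp: sublist_def)
  have "set (vwalk_arcs p) \<subseteq> set (vwalk_arcs q)"
    unfolding q using set_vwalk_arcs_append1 set_vwalk_arcs_append2 by (metis subset_trans)
  with assms q show ?thesis by (auto simp: Path_iff)
qed

text \<open>
  The second form exhibits the second path as a subpath as well.
\<close>

lemma Path_join:
  assumes "p \<in> Path G" "q \<in> Path G" "last p = hd q"
  shows "p @ tl q \<in> Path G" "p @ tl q = butlast p @ q"
proof -
  from assms have ne: "p \<noteq> []" "q \<noteq> []" by (auto simp: Path_iff)
  then show eq: "p @ tl q = butlast p @ q"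
    using assms(3) by (metis append_butlast_last_id append_assoc append_Cons append_Nil list.collapse)
  show "p @ tl q \<in> Path G"
  proof (cases "tl q = []")
    case False
    moreover from this ne have "hd q # tl q \<in> Path G" using assms by simp
    ultimately have "tl q \<in> Path G" "(last p, hd (tl q)) \<in> parcs G"
      using assms(3) Path_append_iff[of "[hd q]" "tl q" G] by auto
    then show ?thesis using False ne assms by (simp add: Path_append_iff)
  qed (use assms in simp)
qed

lemma Path_reaches:
  assumes "p @ x # q \<in> Path G" "y \<in> set (x # q)"
  shows "(x, y) \<in> (parcs G)\<^sup>*"
  using assms
proof (induction q arbitrary: p x)
  case (Cons z q)
  have "(p @ [x]) @ z # q \<in> Path G" using Cons.prems by simp
  moreover from this have "(x, z) \<in> parcs G" by (subst (asm) Path_append_iff) auto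
  ultimately show ?case using Cons.IH[of "p @ [x]" z] Cons.prems(2)
    by (auto intro: converse_rtrancl_into_rtrancl)
qed simp

lemma Path_reaches_from_hd: "p \<in> Path G \<Longrightarrow> x \<in> set p \<Longrightarrow> (hd p, x) \<in> (parcs G)\<^sup>*"
  using Path_reaches[of "[]" "hd p" "tl p"] by (cases p) auto

lemma Path_reaches_last: "p \<in> Path G \<Longrightarrow> x \<in> set p \<Longrightarrow> (x, last p) \<in> (parcs G)\<^sup>*"
  by (metis Path_reaches split_list last_appendR last_in_set list.distinct(1))

lemma reaches_imp_Path:
  assumes "pair_wf_digraph G" "(u, v) \<in> (parcs G)\<^sup>*" "u \<in> pverts G"
  obtains p where "p \<in> Path G" "hd p = u" "last p = v"
proof -
  interpret pair_wf_digraph G by fact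
  from assms(2,3) have "\<exists>p\<in>Path G. hd p = u \<and> last p = v"
  proof (induction rule: rtrancl_induct)
    case base
    then have "[u] \<in> Path G" by (simp add: Path_iff)
    then show ?case by force
  next
    case (step y z)
    then obtain p where p: "p \<in> Path G" "hd p = u" "last p = y" by blast
    moreover have "p \<noteq> []" using p by (simp add: Path_iff)
    moreover have "[z] \<in> Path G" using step.hyps in_arcsD2 by (auto simp: Path_iff)
    ultimately have "p @ [z] \<in> Path G" "hd (p @ [z]) = u" "last (p @ [z]) = z"
      using step.hyps by (simp_all add: Path_append_iff)
    then show ?case by blast
  qed
  with that show thesis by blast
qed

lemma strongly_conn_iff_reaches:
  assumes "pair_wf_digraph G"
  shows "strongly_conn G \<longleftrightarrow> (\<forall>u\<in>pverts G. \<forall>v\<in>pverts G. (u, v) \<in> (parcs G)\<^sup>*)"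
  unfolding strongly_conn_def
  by (metis Path_iff Path_reaches_from_hd assms last_in_set reaches_imp_Path)

lemma reaches_in_pverts:
  assumes "pair_wf_digraph G" "(u, v) \<in> (parcs G)\<^sup>*" "u \<in> pverts G" shows "v \<in> pverts G"
  using assms(2,3) pair_wf_digraph.in_arcsD2[OF assms(1)] by (induction) auto

section \<open>Reversing all arcs\<close>

definition opposite :: "'a pair_pre_digraph \<Rightarrow> 'a pair_pre_digraph" where
  "opposite G = \<lparr> pverts = pverts G, parcs = (parcs G)\<inverse> \<rparr>"

lemma opposite_simps [simp]:
  "pverts (opposite G) = pverts G"
  "parcs (opposite G) = (parcs G)\<inverse>"
  "opposite (opposite G) = G"
  by (simp_all add: opposite_def)

lemma wf_opposite: "pair_wf_digraph G \<Longrightarrow> pair_wf_digraph (opposite G)"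
  by (auto simp: pair_wf_digraph_def)

lemma rev_in_Path_opposite [simp]: "rev p \<in> Path (opposite G) \<longleftrightarrow> p \<in> Path G"
  by (auto simp: Path_iff set_vwalk_arcs_rev)

lemma simple_cycle_rev:
  assumes "simple_cycle G c" shows "simple_cycle (opposite G) (rev c)"
proof -
  from assms have c: "c \<in> Path G" "2 \<le> length c" "hd c = last c" "distinct (butlast c)"
    by (auto simp: simple_cycle_def)
  then obtain x m where "c = x # m" "m \<noteq> []" by (cases c; cases "tl c") auto
  then obtain n where "c = x # n @ [x]" using c(3) by (metis append_butlast_last_id last_ConsR list.sel(1))
  moreover from this have "rev c = x # rev n @ [x]" by simp
  moreover have "rev c \<in> Path (opposite G)" using c(1) by simp
  ultimately show ?thesis using c by (simp add: simple_cycle_def butlast_append)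
qed

lemma simple_cycle_opposite: "simple_cycle (opposite G) c \<longleftrightarrow> simple_cycle G (rev c)"
  by (metis opposite_simps(3) rev_rev_ident simple_cycle_rev)

definition joint_embedding :: "'a pair_pre_digraph \<Rightarrow> bool" where
  "joint_embedding G \<longleftrightarrow>
     (\<forall>p\<in>Path G. \<forall>q\<in>Path G. \<exists>z\<in>Path G. sublist p z \<and> sublist q z)"

lemma joint_embedding_opposite:
  assumes "joint_embedding G" shows "joint_embedding (opposite G)"
  unfolding joint_embedding_def
proof (intro ballI)
  fix p q assume "p \<in> Path (opposite G)" "q \<in> Path (opposite G)"
  then have "rev p \<in> Path G" "rev q \<in> Path G"
    by (metis opposite_simps(3) rev_in_Path_opposite)+
  with assms obtain z where "z \<in> Path G" "sublist (rev p) z" "sublist (rev q) z"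
    unfolding joint_embedding_def by blast
  then show "\<exists>z\<in>Path (opposite G). sublist p z \<and> sublist q z"
    by (intro bexI[of _ "rev z"]) (simp_all add: sublist_rev_right)
qed

section \<open>Deterministic parts and bottleneck arcs\<close>

text \<open>
  Walking along arcs from \<open>v\<close> leaves no choice at any vertex that can be visited.
\<close>

definition deterministic_from :: "'a pair_pre_digraph \<Rightarrow> 'a \<Rightarrow> bool" where
  "deterministic_from G v \<longleftrightarrow>
     (\<forall>x y z. (v, x) \<in> (parcs G)\<^sup>* \<longrightarrow> (x, y) \<in> parcs G \<longrightarrow> (x, z) \<in> parcs G \<longrightarrow> y = z)"

text \<open>
  The first line makes the vertices that reach \<open>u\<close> and those reached from \<open>v\<close> disjoint, the second
  makes them cover the digraph, the third forbids further arcs between the two parts, and the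
  fourth forbids branching in each part, seen from the arc. The formula is invariant under
  reversing all arcs and exchanging \<open>u\<close> with \<open>v\<close>.
\<close>

definition bottleneck :: "'a pair_pre_digraph \<Rightarrow> 'a \<Rightarrow> 'a \<Rightarrow> bool" where
  "bottleneck G u v \<longleftrightarrow> (u, v) \<in> parcs G \<and> (v, u) \<notin> (parcs G)\<^sup>* \<and>
     (\<forall>w\<in>pverts G. (w, u) \<in> (parcs G)\<^sup>* \<or> (v, w) \<in> (parcs G)\<^sup>*) \<and>
     (\<forall>x y. (x, y) \<in> parcs G \<longrightarrow> (x, u) \<in> (parcs G)\<^sup>* \<longrightarrow> (v, y) \<in> (parcs G)\<^sup>* \<longrightarrow> x = u \<and> y = v) \<and>
     deterministic_from (opposite G) u \<and> deterministic_from G v"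

text \<open>
  Where two paths from \<open>v\<close> first differ, the vertex just before has two successors.
\<close>

lemma deterministic_paths_comparable:
  assumes det: "deterministic_from G v"
    and p: "p \<in> Path G" "hd p = v" and q: "q \<in> Path G" "hd q = v"
  shows "prefix p q \<or> prefix q p"
proof (rule ccontr)
  assume "\<not> ?thesis"
  then have "p \<parallel> q" by auto
  then obtain r b bs c cs where "b \<noteq> c" and pq: "p = r @ b # bs" "q = r @ c # cs"
    using parallel_decomp by blast
  with p q have "r \<noteq> []" by auto
  then have "(last r, b) \<in> parcs G" "(last r, c) \<in> parcs G" "(v, last r) \<in> (parcs G)\<^sup>*"
    using p q pq Path_reaches_from_hd[OF p(1), of "last r"] by (simp_all add: Path_append_iff)
  with det \<open>b \<noteq> c\<close> show False unfolding deterministic_from_def by blast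
qed

text \<open>
  Two arcs on one path either occupy the same place, or the end of one reaches the start of the
  other. If returning is impossible, this forces a joint embedding to align the arcs.
\<close>

lemma arcs_on_common_path:
  assumes z: "z \<in> Path G" "z = a @ u # v # b" "z = c @ x # y # d"
  shows "a = c \<or> (y, u) \<in> (parcs G)\<^sup>* \<or> (v, x) \<in> (parcs G)\<^sup>*"
proof -
  have *: "(y, u) \<in> (parcs G)\<^sup>*"
    if "z \<in> Path G" "z = a @ u # v # b" "z = c @ x # y # d" "length c < length a"
    for a b c d and u v x y :: 'a
  proof -
    from that(2-4) have "drop (Suc (length c)) z = drop (Suc (length c)) a @ u # v # b"
      by simp
    with that(3) have "y # d = drop (Suc (length c)) a @ u # v # b" by simp
    then have "u \<in> set (y # d)" by simp
    with Path_reaches[of "c @ [x]" y d] that show ?thesis by simp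
  qed
  consider "length c < length a" | "length a < length c" | "length a = length c" by linarith
  then show ?thesis
  proof cases
    case 1
    show ?thesis using *[OF z 1] by blast
  next
    case 2
    show ?thesis using *[OF z(1,3,2) 2] by blast
  next
    case 3
    with z show ?thesis by (metis append_eq_append_conv)
  qed
qed

section \<open>Joint embedding\<close>

lemma strongly_conn_imp_joint_embedding:
  assumes "strongly_conn G" shows "joint_embedding G"
  unfolding joint_embedding_def
proof (intro ballI)
  fix p q assume pq: "p \<in> Path G" "q \<in> Path G"
  then have "last p \<in> pverts G" "hd q \<in> pverts G" by (auto simp: Path_iff subset_iff)
  with assms obtain r where r: "r \<in> Path G" "hd r = last p" "last r = hd q"
    unfolding strongly_conn_def by blast
  have rq: "r @ tl q \<in> Path G" "r @ tl q = butlast r @ q" using Path_join[OF r(1) pq(2)] r by auto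
  have "hd (r @ tl q) = last p" using r by (auto simp: Path_iff)
  then have "p @ tl (r @ tl q) \<in> Path G" "p @ tl (r @ tl q) = butlast p @ butlast r @ q"
    using Path_join[OF pq(1) rq(1)] rq(2) by auto
  then show "\<exists>z\<in>Path G. sublist p z \<and> sublist q z"
    by (metis sublist_append_rightI sublist_append_leftI append_assoc)
qed

text \<open>
  A path staying before the arc is prolonged to \<open>u\<close>, one staying after it is started from \<open>v\<close>, and
  one that visits both sides must cross by the arc itself.
\<close>

lemma bottleneck_path_extends:
  assumes wf: "pair_wf_digraph G" and bn: "bottleneck G u v" and p: "p \<in> Path G"
  obtains p1 p2 where "p1 \<in> Path G" "last p1 = u" "p2 \<in> Path G" "hd p2 = v" "sublist p (p1 @ p2)"
proof -
  interpret pair_wf_digraph G by fact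
  from bn have uv: "(u, v) \<in> parcs G"
    and cover: "\<And>w. w \<in> pverts G \<Longrightarrow> (w, u) \<in> (parcs G)\<^sup>* \<or> (v, w) \<in> (parcs G)\<^sup>*"
    and cross: "\<And>x y. (x, y) \<in> parcs G \<Longrightarrow> (x, u) \<in> (parcs G)\<^sup>* \<Longrightarrow> (v, y) \<in> (parcs G)\<^sup>* \<Longrightarrow> x = u \<and> y = v"
    unfolding bottleneck_def by blast+
  from uv have V: "u \<in> pverts G" "v \<in> pverts G" by (auto dest: in_arcsD1 in_arcsD2)
  from p have ne: "p \<noteq> []" and pV: "set p \<subseteq> pverts G" by (auto simp: Path_iff)
  show thesis
  proof (cases "(last p, u) \<in> (parcs G)\<^sup>*")
    case True
    with pV ne obtain r where "r \<in> Path G" "hd r = last p" "last r = u"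
      using reaches_imp_Path[OF wf True] by (metis last_in_set subsetD)
    then have "p @ tl r \<in> Path G" "last (p @ tl r) = u"
      using Path_join[OF p] by (auto simp: Path_iff)
    moreover have "[v] \<in> Path G" using V by (simp add: Path_iff)
    moreover have "sublist p ((p @ tl r) @ [v])" by (simp add: sublist_append_rightI)
    ultimately show ?thesis using that by (metis list.sel(1))
  next
    case False
    \<comment> \<open>The last vertex lies behind the arc; cut the path where it first gets there.\<close>
    let ?Q = "\<lambda>x. (x, u) \<in> (parcs G)\<^sup>*"
    define p1 p2 where "p1 = takeWhile ?Q p" and "p2 = dropWhile ?Q p"
    have p12: "p = p1 @ p2" by (simp add: p1_def p2_def)
    have ne2: "p2 \<noteq> []" using False ne by (auto simp: p2_def dropWhile_eq_Nil_conv)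
    then have "\<not> ?Q (hd p2)" unfolding p2_def by (rule hd_dropWhile)
    moreover have "hd p2 \<in> pverts G" using ne2 p12 pV by auto
    ultimately have vp2: "(v, hd p2) \<in> (parcs G)\<^sup>*" using cover by blast
    have p2: "p2 \<in> Path G" using p p12 ne2 by (metis Path_sublist sublist_append_leftI)
    show ?thesis
    proof (cases "p1 = []")
      case True
      obtain r where r: "r \<in> Path G" "hd r = v" "last r = hd p2"
        using reaches_imp_Path[OF wf vp2 V(2)] .
      then have "r @ tl p2 \<in> Path G" "r @ tl p2 = butlast r @ p2"
        using Path_join[OF r(1) p2] by blast+
      moreover have "hd (r @ tl p2) = v" using r by (auto simp: Path_iff)
      moreover have "[u] \<in> Path G" using V by (simp add: Path_iff)
      moreover have "sublist p ([u] @ r @ tl p2)"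
        using True p12 calculation(2) by (metis append_Nil append_assoc sublist_append_leftI)
      ultimately show ?thesis using that by (metis last.simps)
    next
      case False
      with p p12 ne2 have "p1 \<in> Path G" and a: "(last p1, hd p2) \<in> parcs G"
        by (auto simp: Path_append_iff)
      moreover have "?Q (last p1)" using False by (metis last_in_set p1_def set_takeWhileD)
      then have "last p1 = u \<and> hd p2 = v" using cross[OF a _ vp2] by blast
      ultimately show ?thesis using that p2 p12 by blast
    qed
  qed
qed

lemma bottleneck_imp_joint_embedding:
  assumes wf: "pair_wf_digraph G" and bn: "bottleneck G u v"
  shows "joint_embedding G"
  unfolding joint_embedding_def
proof (intro ballI)
  fix p q assume pq: "p \<in> Path G" "q \<in> Path G"
  obtain p1 p2 where p: "p1 \<in> Path G" "last p1 = u" "p2 \<in> Path G" "hd p2 = v" "sublist p (p1 @ p2)"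
    using bottleneck_path_extends[OF wf bn pq(1)] .
  obtain q1 q2 where q: "q1 \<in> Path G" "last q1 = u" "q2 \<in> Path G" "hd q2 = v" "sublist q (q1 @ q2)"
    using bottleneck_path_extends[OF wf bn pq(2)] .
  from bn have uv: "(u, v) \<in> parcs G" and det: "deterministic_from (opposite G) u" "deterministic_from G v"
    by (auto simp: bottleneck_def)
  have "prefix (rev p1) (rev q1) \<or> prefix (rev q1) (rev p1)"
    using deterministic_paths_comparable[OF det(1), of "rev p1" "rev q1"] p q
    by (simp add: hd_rev)
  then have "suffix p1 q1 \<or> suffix q1 p1" by (simp add: suffix_to_prefix)
  then obtain z1 where z1: "z1 \<in> Path G" "last z1 = u" "suffix p1 z1" "suffix q1 z1"
    using p q by blast
  have "prefix p2 q2 \<or> prefix q2 p2"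
    using deterministic_paths_comparable[OF det(2)] p q by blast
  then obtain z2 where z2: "z2 \<in> Path G" "hd z2 = v" "prefix p2 z2" "prefix q2 z2"
    using p q by blast
  have "z1 @ z2 \<in> Path G" using z1 z2 uv by (subst Path_append_iff) (auto simp: Path_iff)
  moreover have "sublist (r1 @ r2) (z1 @ z2)" if "suffix r1 z1" "prefix r2 z2" for r1 r2
    using that unfolding suffix_def prefix_def sublist_def by force
  ultimately show "\<exists>z\<in>Path G. sublist p z \<and> sublist q z"
    using p(5) q(5) z1 z2 by (meson sublist_order.order_trans)
qed

text \<open>
  Given two successors of a vertex \<open>x\<close> reached from \<open>v\<close>, follow one path from the arc \<open>u \<rightarrow> v\<close> to
  \<open>x\<close> and from there to either successor. In a common extension both begin at the unique
  occurrence of the arc, so they take the same step after \<open>x\<close>.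
\<close>

lemma joint_embedding_deterministic:
  assumes wf: "pair_wf_digraph G" and je: "joint_embedding G"
    and uv: "(u, v) \<in> parcs G" and nr: "(v, u) \<notin> (parcs G)\<^sup>*"
  shows "deterministic_from G v"
  unfolding deterministic_from_def
proof (intro allI impI)
  interpret pair_wf_digraph G by fact
  fix x y y' assume vx: "(v, x) \<in> (parcs G)\<^sup>*" and y: "(x, y) \<in> parcs G" and y': "(x, y') \<in> parcs G"
  obtain r where r: "r \<in> Path G" "hd r = v" "last r = x"
    using reaches_imp_Path[OF wf vx in_arcsD2[OF uv]] .
  then obtain r' where r': "r = v # r'" by (cases r) (auto simp: Path_iff)
  have "u # r @ [w] \<in> Path G" if "(x, w) \<in> parcs G" for w
  proof -
    have "r @ [w] \<in> Path G"
      using r r' that in_arcsD2[OF that] by (subst Path_append_iff) (auto simp: Path_iff)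
    then have "[u] @ (r @ [w]) \<in> Path G"
      using r' uv in_arcsD1[OF uv] by (subst Path_append_iff) (auto simp: Path_iff)
    then show ?thesis by simp
  qed
  from this[OF y] this[OF y'] obtain z where z: "z \<in> Path G" "sublist (u # r @ [y]) z" "sublist (u # r @ [y']) z"
    using je unfolding joint_embedding_def by blast
  obtain a b where eq1: "z = a @ u # v # (r' @ y # b)" using z(2) by (auto simp: sublist_def r')
  obtain c d where eq2: "z = c @ u # v # (r' @ y' # d)" using z(3) by (auto simp: sublist_def r')
  from arcs_on_common_path[OF z(1) eq1 eq2] nr have "a = c" by blast
  with eq1 eq2 show "y = y'" by simp
qed

text \<open>
  The bottleneck conditions come from embedding the arc jointly with a single vertex (covering),
  with another arc (uniqueness of the crossing), and with branching paths in the digraph and in its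
  opposite (determinism).
\<close>

lemma joint_embedding_imp_bottleneck:
  assumes wf: "pair_wf_digraph G" and je: "joint_embedding G"
    and uv: "(u, v) \<in> parcs G" and nr: "(v, u) \<notin> (parcs G)\<^sup>*"
  shows "bottleneck G u v"
proof -
  interpret pair_wf_digraph G by fact
  have arc_path: "[x, y] \<in> Path G" if "(x, y) \<in> parcs G" for x y
    using in_arcsD1[OF that] in_arcsD2[OF that] that by (simp add: Path_iff)
  have "(w, u) \<in> (parcs G)\<^sup>* \<or> (v, w) \<in> (parcs G)\<^sup>*" if "w \<in> pverts G" for w
  proof -
    have "[w] \<in> Path G" using that by (simp add: Path_iff)
    then obtain z where z: "z \<in> Path G" "sublist [w] z" "sublist [u, v] z"
      using je arc_path[OF uv] unfolding joint_embedding_def by blast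
    then obtain a b where eq: "z = (a @ [u]) @ v # b" by (auto simp: sublist_def)
    have "w \<in> set z" using z(2) by (auto simp: sublist_def)
    with eq consider "w \<in> set (a @ [u])" | "w \<in> set (v # b)" by auto
    then show ?thesis
    proof cases
      case 1
      moreover have "a @ [u] \<in> Path G" using z(1) eq by (subst (asm) eq, subst (asm) Path_append_iff) auto
      ultimately show ?thesis using Path_reaches_last by fastforce
    next
      case 2
      then show ?thesis using Path_reaches z(1) eq by metis
    qed
  qed
  moreover have "x = u \<and> y = v"
    if xy: "(x, y) \<in> parcs G" "(x, u) \<in> (parcs G)\<^sup>*" "(v, y) \<in> (parcs G)\<^sup>*" for x y
  proof -
    obtain z where z: "z \<in> Path G" "sublist [x, y] z" "sublist [u, v] z"
      using je arc_path[OF uv] arc_path[OF xy(1)] unfolding joint_embedding_def by blast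
    obtain a b where eq1: "z = a @ u # v # b" using z(3) by (auto simp: sublist_def)
    obtain c d where eq2: "z = c @ x # y # d" using z(2) by (auto simp: sublist_def)
    have "(y, u) \<notin> (parcs G)\<^sup>*" "(v, x) \<notin> (parcs G)\<^sup>*" using nr xy by (meson rtrancl_trans)+
    with arcs_on_common_path[OF z(1) eq1 eq2] have "a = c" by blast
    with eq1 eq2 show ?thesis by simp
  qed
  moreover have "deterministic_from (opposite G) u"
    by (rule joint_embedding_deterministic[of _ v])
      (use wf je uv nr in \<open>simp_all add: wf_opposite joint_embedding_opposite rtrancl_converse\<close>)
  moreover have "deterministic_from G v" using joint_embedding_deterministic[OF assms] .
  ultimately show ?thesis using uv nr unfolding bottleneck_def by blast
qed

text \<open>
  If every arc could be undone, so could every path.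
\<close>

lemma one_way_arc_exists:
  assumes "(x, y) \<in> E\<^sup>*" "(y, x) \<notin> E\<^sup>*"
  shows "\<exists>u v. (u, v) \<in> E \<and> (v, u) \<notin> E\<^sup>*"
  using assms
proof (induction rule: rtrancl_induct)
  case (step y z)
  then show ?case by (meson rtrancl_trans)
qed simp

lemma joint_embedding_not_strongly_conn:
  assumes wf: "pair_wf_digraph G" and je: "joint_embedding G" and "\<not> strongly_conn G"
  shows "\<exists>u v. bottleneck G u v"
proof -
  from assms(3) obtain x y where xy: "x \<in> pverts G" "y \<in> pverts G" "(y, x) \<notin> (parcs G)\<^sup>*"
    unfolding strongly_conn_iff_reaches[OF wf] by blast
  then have "[x] \<in> Path G" "[y] \<in> Path G" by (simp_all add: Path_iff)
  then obtain z where z: "z \<in> Path G" "sublist [x] z" "sublist [y] z"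
    using je unfolding joint_embedding_def by blast
  then obtain a b where ab: "z = a @ x # b" by (auto simp: sublist_def)
  have "y \<in> set z" using z(3) by (auto simp: sublist_def)
  then obtain c d where cd: "z = c @ y # d" by (meson split_list)
  have "x \<in> set (y # d) \<or> y \<in> set (x # b)"
    using ab cd by (auto simp: append_eq_append_conv2 Cons_eq_append_conv append_eq_Cons_conv)
  then have "(y, x) \<in> (parcs G)\<^sup>* \<or> (x, y) \<in> (parcs G)\<^sup>*"
    using Path_reaches z(1) ab cd by metis
  with xy one_way_arc_exists obtain u v where "(u, v) \<in> parcs G" "(v, u) \<notin> (parcs G)\<^sup>*" by metis
  then show ?thesis using joint_embedding_imp_bottleneck[OF wf je] by blast
qed

section \<open>Bicycles\<close>

text \<open>
  A simple path, possibly running into a simple cycle at its end, such that every arc starting at one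
  of its vertices belongs to it. This is the half of a bicycle with the terminal cycle; the half with
  the initial cycle is one in the opposite digraph.
\<close>

definition lasso :: "'a pair_pre_digraph \<Rightarrow> 'a list \<Rightarrow> 'a list \<Rightarrow> bool" where
  "lasso G t c \<longleftrightarrow> simple_path G t \<and> (c = [] \<or> simple_cycle G c \<and> set t \<inter> set c = {last t}) \<and>
     {(x, y) \<in> parcs G. x \<in> set t \<union> set c} = set (vwalk_arcs t) \<union> set (vwalk_arcs c)"

text \<open>
  The common first and last vertex is reached from \<open>x\<close> and reaches \<open>y\<close>.
\<close>

lemma simple_cycle_reaches:
  assumes "simple_cycle G c" "x \<in> set c" "y \<in> set c" shows "(x, y) \<in> (parcs G)\<^sup>*"
  using assms Path_reaches_last[of c G x] Path_reaches_from_hd[of c G y]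
  by (auto simp: simple_cycle_def)

lemma lasso_reaches:
  assumes l: "lasso G t c" shows "(parcs G)\<^sup>* `` {hd t} = set t \<union> set c"
proof -
  from l have t: "t \<in> Path G" "hd t \<in> set t"
    and c: "c = [] \<or> simple_cycle G c \<and> set t \<inter> set c = {last t}"
    and arcs: "{(x, y) \<in> parcs G. x \<in> set t \<union> set c} = set (vwalk_arcs t) \<union> set (vwalk_arcs c)"
    by (auto simp: lasso_def simple_path_def Path_iff)
  have "x \<in> set t \<union> set c" if "(hd t, x) \<in> (parcs G)\<^sup>*" for x
    using that
  proof (induction rule: rtrancl_induct)
    case (step y z)
    then have "(y, z) \<in> set (vwalk_arcs t) \<union> set (vwalk_arcs c)" using arcs by blast
    then show ?case by (auto dest: vwalk_arc_ends(2))
  qed (use t in simp)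
  moreover have "(hd t, x) \<in> (parcs G)\<^sup>*" if x: "x \<in> set t \<union> set c" for x
  proof (cases "x \<in> set t")
    case True
    then show ?thesis using Path_reaches_from_hd[OF t(1)] by blast
  next
    case False
    with x c have "simple_cycle G c" "last t \<in> set c" "x \<in> set c" by auto
    then have "(last t, x) \<in> (parcs G)\<^sup>*" by (rule simple_cycle_reaches)
    moreover have "(hd t, last t) \<in> (parcs G)\<^sup>*"
      using Path_reaches_last[OF t] .
    ultimately show ?thesis by (rule rtrancl_trans[rotated])
  qed
  ultimately show ?thesis by auto
qed

text \<open>
  Arcs of the path start before its end and arcs of the cycle on the cycle; as these meet only in the
  end of the path, no vertex starts arcs of both kinds.
\<close>

lemma lasso_deterministic:
  assumes l: "lasso G t c" shows "deterministic_from G (hd t)"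
  unfolding deterministic_from_def
proof (intro allI impI)
  fix x y z assume "(hd t, x) \<in> (parcs G)\<^sup>*" and E: "(x, y) \<in> parcs G" "(x, z) \<in> parcs G"
  then have x: "x \<in> set t \<union> set c" using lasso_reaches[OF l] by blast
  from l have t: "distinct t" "t \<noteq> []"
    and c: "c = [] \<or> simple_cycle G c \<and> set t \<inter> set c = {last t}"
    and arcs: "{(x, y) \<in> parcs G. x \<in> set t \<union> set c} = set (vwalk_arcs t) \<union> set (vwalk_arcs c)"
    by (auto simp: lasso_def simple_path_def Path_iff)
  from x E arcs have "(x, y) \<in> set (vwalk_arcs t) \<union> set (vwalk_arcs c)"
    "(x, z) \<in> set (vwalk_arcs t) \<union> set (vwalk_arcs c)" by blast+
  moreover have "set (butlast t) \<inter> set (butlast c) = {}"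
  proof -
    have "distinct (butlast t @ [last t])" using t by simp
    then have "set (butlast t) \<subseteq> set t - {last t}" by (auto dest: in_set_butlastD)
    moreover have "set (butlast c) \<subseteq> set c" by (auto dest: in_set_butlastD)
    ultimately show ?thesis using c by (cases "c = []") (simp, blast)
  qed
  moreover have "distinct (butlast t)" "distinct (butlast c)"
    using t c by (auto simp: distinct_butlast simple_cycle_def)
  ultimately show "y = z"
    using vwalk_arcs_unique_successor source_of_vwalk_arc by (metis UnE disjoint_iff)
qed

text \<open>
  A longest simple path from \<open>v\<close> cannot be prolonged, so its last vertex has either no successor or a
  single one lying on the path. In the second case the path closes up there, and the part from that
  vertex on is the cycle.
\<close>

lemma deterministic_lasso_exists:
  assumes wf: "pair_wf_digraph G" and fin: "finite (pverts G)"
    and v: "v \<in> pverts G" and det: "deterministic_from G v"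
  obtains t c where "lasso G t c" "hd t = v"
proof -
  interpret pair_wf_digraph G by fact
  let ?T = "\<lambda>t. simple_path G t \<and> hd t = v"
  have "?T [v]" using v by (simp add: simple_path_def Path_iff)
  moreover have "length t < Suc (card (pverts G))" if "?T t" for t
    using that card_mono[OF fin, of "set t"] distinct_card[of t]
    by (auto simp: simple_path_def Path_iff)
  ultimately obtain t where t: "?T t" and max: "\<And>s. ?T s \<Longrightarrow> length s \<le> length t"
    using ex_has_greatest_nat[of ?T "[v]" length "Suc (card (pverts G))"] by (metis less_imp_le)
  from t have tP: "t \<in> Path G" "distinct t" "t \<noteq> []" "hd t = v"
    by (auto simp: simple_path_def Path_iff)
  have from_v: "(v, x) \<in> (parcs G)\<^sup>*" if "x \<in> set t" for x
    using Path_reaches_from_hd[OF tP(1) that] tP(4) by simp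
  have succ: "y \<in> set t" if y: "(last t, y) \<in> parcs G" for y
  proof (rule ccontr)
    assume "y \<notin> set t"
    moreover have "[y] \<in> Path G" using in_arcsD2[OF y] by (simp add: Path_iff)
    ultimately have "?T (t @ [y])"
      using tP y by (simp add: simple_path_def Path_append_iff)
    from max[OF this] show False by simp
  qed
  \<comment> \<open>No vertex of \<open>t\<close> starts two arcs, so a set of such arcs is complete once it provides a successor
    for every vertex that has one.\<close>
  have arcs: "{(x, y) \<in> parcs G. x \<in> set t} = F"
    if "F \<subseteq> parcs G" "fst ` F \<subseteq> set t" "\<And>x y. x \<in> set t \<Longrightarrow> (x, y) \<in> parcs G \<Longrightarrow> \<exists>z. (x, z) \<in> F" for F
  proof -
    have "(x, y) \<in> F" if x: "x \<in> set t" and xy: "(x, y) \<in> parcs G" for x y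
    proof -
      obtain z where z: "(x, z) \<in> F"
        using \<open>\<And>x y. x \<in> set t \<Longrightarrow> (x, y) \<in> parcs G \<Longrightarrow> \<exists>z. (x, z) \<in> F\<close>[OF x xy] ..
      then have "(x, z) \<in> parcs G" using \<open>F \<subseteq> parcs G\<close> by blast
      with from_v[OF x] xy det have "y = z" unfolding deterministic_from_def by blast
      with z show ?thesis by simp
    qed
    with that(1,2) show ?thesis by force
  qed
  have set_t: "set t = insert (last t) (set (butlast t))"
    using tP(3) by (metis append_butlast_last_id Un_insert_right list.simps(15) set_append sup_bot_right empty_set)
  show thesis
  proof (cases "\<exists>x. (last t, x) \<in> parcs G")
    case False
    have "{(x, y) \<in> parcs G. x \<in> set t} = set (vwalk_arcs t)"
    proof (rule arcs)
      show "set (vwalk_arcs t) \<subseteq> parcs G" using tP by (simp add: Path_iff)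
      show "fst ` set (vwalk_arcs t) \<subseteq> set t" by (auto dest: vwalk_arc_ends(1))
      show "\<exists>z. (x, z) \<in> set (vwalk_arcs t)" if "x \<in> set t" "(x, y) \<in> parcs G" for x y
        using that False set_t vertex_has_vwalk_arc by auto
    qed
    then have "lasso G t []" using t by (simp add: lasso_def)
    then show ?thesis using that tP by blast
  next
    case True
    then obtain x where x: "(last t, x) \<in> parcs G" by blast
    from succ[OF x] obtain a b where ab: "t = a @ x # b" by (meson split_list)
    let ?s = "a @ [x]" and ?c = "x # b @ [x]"
    have tx: "t @ [x] \<in> Path G" using tP x in_arcsD2[OF x] by (simp add: Path_append_iff) (simp add: Path_iff)
    have "sublist ?s (t @ [x])" "sublist ?c (t @ [x])"
      unfolding ab sublist_def by (rule exI[of _ "[]"], force) (rule exI[of _ a], force)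
    then have sP: "?s \<in> Path G" and cP: "?c \<in> Path G"
      using Path_sublist[OF tx] by blast+
    have "simple_path G ?s" "simple_cycle G ?c"
      using sP cP tP(2) unfolding ab simple_path_def simple_cycle_def by (auto simp: butlast_append)
    moreover have "set ?s \<inter> set ?c = {last ?s}" using tP(2) unfolding ab by auto
    moreover have sc: "set ?s \<union> set ?c = set t" unfolding ab by auto
    moreover have "{(x, y) \<in> parcs G. x \<in> set t} = set (vwalk_arcs ?s) \<union> set (vwalk_arcs ?c)" (is "_ = ?F")
    proof (rule arcs)
      show "?F \<subseteq> parcs G" using sP cP by (simp add: Path_iff)
      show "fst ` ?F \<subseteq> set t"
      proof
        fix w assume "w \<in> fst ` ?F"
        then obtain z where "(w, z) \<in> ?F" by (metis imageE prod.collapse)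
        then show "w \<in> set t"
          using sc vwalk_arc_ends(1)[of w z ?s] vwalk_arc_ends(1)[of w z ?c] by blast
      qed
      show "\<exists>z. (w, z) \<in> ?F" if w: "w \<in> set t" for w
      proof -
        have "set t = set (butlast ?s) \<union> set (butlast ?c)" unfolding ab by (auto simp: butlast_append)
        with w show ?thesis using vertex_has_vwalk_arc[of w ?s] vertex_has_vwalk_arc[of w ?c] by blast
      qed
    qed
    ultimately have "lasso G ?s ?c" unfolding lasso_def sc by blast
    moreover have "hd ?s = v" using tP(4) unfolding ab by (cases a) auto
    ultimately show ?thesis using that by blast
  qed
qed

text \<open>
  The lasso of the opposite digraph at \<open>u\<close> is turned round and glued to the lasso at \<open>v\<close> by the
  arc; its cycle becomes the initial cycle, and the two paths together the connecting path.
\<close>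

lemma bottleneck_imp_bicycle:
  assumes wf: "pair_wf_digraph G" and fin: "finite (pverts G)" and bn: "bottleneck G u v"
  shows "bicycle G"
proof -
  interpret pair_wf_digraph G by fact
  from bn have uv: "(u, v) \<in> parcs G" and nr: "(v, u) \<notin> (parcs G)\<^sup>*"
    and cover: "\<And>w. w \<in> pverts G \<Longrightarrow> (w, u) \<in> (parcs G)\<^sup>* \<or> (v, w) \<in> (parcs G)\<^sup>*"
    and cross: "\<And>x y. (x, y) \<in> parcs G \<Longrightarrow> (x, u) \<in> (parcs G)\<^sup>* \<Longrightarrow> (v, y) \<in> (parcs G)\<^sup>* \<Longrightarrow> x = u \<and> y = v"
    and det: "deterministic_from (opposite G) u" "deterministic_from G v"
    unfolding bottleneck_def by blast+
  from uv have V: "u \<in> pverts G" "v \<in> pverts G" by (auto dest: in_arcsD1 in_arcsD2)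
  obtain t2 c2 where l2: "lasso G t2 c2" "hd t2 = v"
    using deterministic_lasso_exists[OF wf fin V(2) det(2)] .
  obtain t1 c1 where l1: "lasso (opposite G) t1 c1" "hd t1 = u"
    using deterministic_lasso_exists[of "opposite G" u] wf_opposite[OF wf] fin V(1) det(1) by auto
  have A: "set t1 \<union> set c1 = {x. (x, u) \<in> (parcs G)\<^sup>*}"
    using lasso_reaches[OF l1(1)] l1(2) by (auto simp: rtrancl_converse)
  have B: "set t2 \<union> set c2 = {x. (v, x) \<in> (parcs G)\<^sup>*}"
    using lasso_reaches[OF l2(1)] l2(2) by auto
  have disj: "(set t1 \<union> set c1) \<inter> (set t2 \<union> set c2) = {}"
    unfolding A B using nr by (auto dest: rtrancl_trans)
  have "t1 \<in> Path (opposite G)" and dt1: "distinct t1"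
    using l1 by (auto simp: lasso_def simple_path_def)
  then have rP: "rev t1 \<in> Path G" by (metis opposite_simps(3) rev_in_Path_opposite)
  then have ne1: "t1 \<noteq> []" by (auto simp: Path_iff)
  then have "last (rev t1) = u" using l1(2) by (simp add: last_rev)
  note t1 = rP dt1 ne1 this
  have t2: "t2 \<in> Path G" "distinct t2" "t2 \<noteq> []"
    using l2 by (auto simp: lasso_def simple_path_def Path_iff)
  let ?t = "rev t1 @ t2"
  have "simple_path G ?t"
    using t1 t2 uv l2(2) disj by (auto simp: simple_path_def Path_append_iff)
  moreover have "rev c1 = [] \<or> simple_cycle G (rev c1)" "c2 = [] \<or> simple_cycle G c2"
    using l1 l2 by (auto simp: lasso_def simple_cycle_opposite)
  moreover have "set (rev c1) \<inter> set c2 = {}" using disj by auto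
  moreover have "rev c1 \<noteq> [] \<longrightarrow> set ?t \<inter> set (rev c1) = {hd ?t}"
  proof
    assume "rev c1 \<noteq> []"
    then have "set t1 \<inter> set c1 = {last t1}" using l1 by (auto simp: lasso_def)
    then show "set ?t \<inter> set (rev c1) = {hd ?t}"
      using disj t1(3) by (simp add: hd_rev Int_Un_distrib2 Int_commute) blast
  qed
  moreover have "c2 \<noteq> [] \<longrightarrow> set ?t \<inter> set c2 = {last ?t}"
  proof
    assume "c2 \<noteq> []"
    then have "set t2 \<inter> set c2 = {last t2}" using l2 by (auto simp: lasso_def)
    then show "set ?t \<inter> set c2 = {last ?t}"
      using disj t2(3) by (simp add: Int_Un_distrib2) blast
  qed
  moreover have "pverts G = set (rev c1) \<union> set ?t \<union> set c2"
  proof -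
    have "set (rev c1) \<union> set ?t \<union> set c2 = (set t1 \<union> set c1) \<union> (set t2 \<union> set c2)" by auto
    also have "\<dots> = {x. (x, u) \<in> (parcs G)\<^sup>*} \<union> {x. (v, x) \<in> (parcs G)\<^sup>*}" unfolding A B ..
    also have "\<dots> = pverts G"
      using cover reaches_in_pverts[OF wf _ V(2)] reaches_in_pverts[OF wf_opposite[OF wf], of u] V(1)
      by (auto simp: rtrancl_converse)
    finally show ?thesis ..
  qed
  moreover have "parcs G = set (vwalk_arcs (rev c1)) \<union> set (vwalk_arcs ?t) \<union> set (vwalk_arcs c2)"
  proof -
    have F1: "{(y, x) \<in> parcs G. x \<in> set t1 \<union> set c1} = (set (vwalk_arcs t1) \<union> set (vwalk_arcs c1))\<inverse>"
    proof -
      have "{(x, y) \<in> parcs (opposite G). x \<in> set t1 \<union> set c1} = set (vwalk_arcs t1) \<union> set (vwalk_arcs c1)"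
        using l1(1) unfolding lasso_def by blast
      from this[symmetric] show ?thesis by auto
    qed
    have F2: "{(x, y) \<in> parcs G. x \<in> set t2 \<union> set c2} = set (vwalk_arcs t2) \<union> set (vwalk_arcs c2)"
      using l2(1) unfolding lasso_def by blast
    have "parcs G = {(y, x) \<in> parcs G. x \<in> set t1 \<union> set c1} \<union> {(u, v)} \<union> {(x, y) \<in> parcs G. x \<in> set t2 \<union> set c2}"
    proof -
      have "y \<in> set t1 \<union> set c1 \<or> x = u \<and> y = v \<or> x \<in> set t2 \<union> set c2" if "(x, y) \<in> parcs G" for x y
        using cross[OF that] cover[OF in_arcsD1[OF that]] cover[OF in_arcsD2[OF that]]
        unfolding A B by blast
      then show ?thesis using uv by blast
    qed
    also have "\<dots> = set (vwalk_arcs (rev c1)) \<union> set (vwalk_arcs ?t) \<union> set (vwalk_arcs c2)"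
      unfolding F1 F2 using t1 t2 l2(2) by (auto simp: vwalk_arcs_append set_vwalk_arcs_rev)
    finally show ?thesis .
  qed
  ultimately show ?thesis unfolding bicycle_def
    by - (rule exI[of _ "rev c1"], rule exI[of _ ?t], rule exI[of _ c2], intro conjI; assumption)
qed

text \<open>
  The bottleneck is the first arc \<open>u \<rightarrow> v\<close> of the connecting path: the rest of that path with the
  terminal cycle is a lasso at \<open>v\<close>, and the initial cycle with the trivial path at \<open>u\<close> is one in the
  opposite digraph.
\<close>

lemma bicycle_imp_bottleneck:
  assumes wf: "pair_wf_digraph G" and bi: "bicycle G" and nsc: "\<not> strongly_conn G"
  shows "\<exists>u v. bottleneck G u v"
proof -
  from bi obtain c1 t c2 where
      c1: "c1 = [] \<or> simple_cycle G c1" and t: "simple_path G t" and c2: "c2 = [] \<or> simple_cycle G c2"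
    and c12: "set c1 \<inter> set c2 = {}"
    and tc1: "c1 \<noteq> [] \<longrightarrow> set t \<inter> set c1 = {hd t}" and tc2: "c2 \<noteq> [] \<longrightarrow> set t \<inter> set c2 = {last t}"
    and V: "pverts G = set c1 \<union> set t \<union> set c2"
    and E: "parcs G = set (vwalk_arcs c1) \<union> set (vwalk_arcs t) \<union> set (vwalk_arcs c2)"
    unfolding bicycle_def by blast
  have "\<exists>u v b. t = u # v # b"
  proof (rule ccontr)
    assume "\<not> ?thesis"
    then obtain w where w: "t = [w]"
      using t by (cases t rule: remdups_adj.cases) (auto simp: simple_path_def Path_iff)
    have w1: "c1 \<noteq> [] \<Longrightarrow> w \<in> set c1" and w2: "c2 \<noteq> [] \<Longrightarrow> w \<in> set c2" using tc1 tc2 w by auto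
    \<comment> \<open>A trivial connecting path leaves room for one cycle only.\<close>
    have "c1 = [] \<or> c2 = []" using w1 w2 c12 by blast
    then have "\<exists>c. pverts G = insert w (set c) \<and> (c = [] \<or> simple_cycle G c \<and> w \<in> set c)"
    proof
      assume "c1 = []"
      then show ?thesis using c2 w2 V w by (intro exI[of _ c2]) auto
    next
      assume "c2 = []"
      then show ?thesis using c1 w1 V w by (intro exI[of _ c1]) auto
    qed
    then obtain c where "pverts G = insert w (set c)" "c = [] \<or> simple_cycle G c \<and> w \<in> set c"
      by blast
    then have "\<forall>x\<in>pverts G. \<forall>y\<in>pverts G. (x, y) \<in> (parcs G)\<^sup>*"
      using simple_cycle_reaches by fastforce
    with nsc show False by (simp add: strongly_conn_iff_reaches[OF wf])
  qed
  then obtain u v b where tuv: "t = u # v # b" by blast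
  from t have tP: "t \<in> Path G" and dist: "distinct t" by (auto simp: simple_path_def)
  have ht: "hd t = u" and lt: "last t = last (v # b)" "last t \<in> set (v # b)"
    and st: "set t = insert u (set (v # b))" and ub: "u \<notin> set (v # b)"
    using dist unfolding tuv by auto
  have "set t \<inter> set c2 \<subseteq> {last t}" using tc2 by (cases "c2 = []") auto
  then have u2: "u \<notin> set (v # b) \<union> set c2" using lt(2) st ub by blast
  have "set t \<inter> set c1 \<subseteq> {u}" using tc1 ht by (cases "c1 = []") auto
  then have c1B: "set c1 \<inter> (set (v # b) \<union> set c2) = {}" using c12 st ub by blast
  have ends: "set (vwalk_arcs p) \<subseteq> set p \<times> set p" for p :: "'a list"
    using vwalk_arc_ends by fastforce
  note ends = ends[of c1] ends[of "v # b"] ends[of c2]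
  have Et: "set (vwalk_arcs t) = insert (u, v) (set (vwalk_arcs (v # b)))" by (simp add: tuv)
  have vb: "v # b \<in> Path G" using tP tuv Path_append_iff[of "[u]" "v # b" G] by simp
  have l2: "lasso G (v # b) c2"
    unfolding lasso_def
  proof (intro conjI)
    show "simple_path G (v # b)" using vb dist tuv by (simp add: simple_path_def)
    show "c2 = [] \<or> simple_cycle G c2 \<and> set (v # b) \<inter> set c2 = {last (v # b)}"
    proof -
      have "set (v # b) \<inter> set c2 = set t \<inter> set c2" unfolding st using u2 by blast
      then show ?thesis using c2 tc2 lt(1) by metis
    qed
    show "{(x, y) \<in> parcs G. x \<in> set (v # b) \<union> set c2} = set (vwalk_arcs (v # b)) \<union> set (vwalk_arcs c2)"
      using u2 c1B ends unfolding E Et by blast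
  qed
  have l1: "lasso (opposite G) [u] (rev c1)"
    unfolding lasso_def
  proof (intro conjI)
    show "simple_path (opposite G) [u]" using V tuv by (simp add: simple_path_def Path_iff)
    show "rev c1 = [] \<or> simple_cycle (opposite G) (rev c1) \<and> set [u] \<inter> set (rev c1) = {last [u]}"
      using c1 tc1 tuv by (auto simp: simple_cycle_opposite)
    have "y \<notin> {u} \<union> set c1" if "(x, y) \<in> set (vwalk_arcs t) \<union> set (vwalk_arcs c2)" for x y
    proof -
      have "y \<in> set (v # b) \<union> set c2" using that ends list.set_intros(1)[of v b] unfolding Et by blast
      then show ?thesis using c1B u2 by blast
    qed
    then have "{(x, y) \<in> parcs G. y \<in> {u} \<union> set c1} = set (vwalk_arcs c1)"
      using ends unfolding E by blast
    from this[symmetric] show "{(x, y) \<in> parcs (opposite G). x \<in> set [u] \<union> set (rev c1)}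
        = set (vwalk_arcs [u]) \<union> set (vwalk_arcs (rev c1))"
      by (auto simp: set_vwalk_arcs_rev)
  qed
  have A: "(x, u) \<in> (parcs G)\<^sup>* \<longleftrightarrow> x \<in> insert u (set c1)" for x
    using lasso_reaches[OF l1] by (auto simp: rtrancl_converse)
  have B: "(v, x) \<in> (parcs G)\<^sup>* \<longleftrightarrow> x \<in> set (v # b) \<union> set c2" for x
    using lasso_reaches[OF l2] by auto
  have "(u, v) \<in> parcs G" unfolding E Et by simp
  moreover have "(v, u) \<notin> (parcs G)\<^sup>*" unfolding B using u2 by simp
  moreover have "(w, u) \<in> (parcs G)\<^sup>* \<or> (v, w) \<in> (parcs G)\<^sup>*" if "w \<in> pverts G" for w
    using that unfolding A B V tuv by auto
  moreover have "x = u \<and> y = v" if "(x, y) \<in> parcs G" "(x, u) \<in> (parcs G)\<^sup>*" "(v, y) \<in> (parcs G)\<^sup>*" for x y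
  proof -
    have "x \<notin> set (v # b) \<union> set c2" "y \<notin> set c1" using that u2 c1B unfolding A B by blast+
    then have "(x, y) \<notin> set (vwalk_arcs c1)" "(x, y) \<notin> set (vwalk_arcs (v # b))"
      "(x, y) \<notin> set (vwalk_arcs c2)" using ends by blast+
    then show ?thesis using that(1) unfolding E Et by blast
  qed
  moreover have "deterministic_from (opposite G) u" using lasso_deterministic[OF l1] by simp
  moreover have "deterministic_from G v" using lasso_deterministic[OF l2] by simp
  ultimately show ?thesis unfolding bottleneck_def by blast
qed

section \<open>The characterisation\<close>

theorem theorem2p1:
  fixes G :: "'a pair_pre_digraph"
  assumes "pair_fin_digraph G"
  shows "atomic_poset (Path G) sublist \<longleftrightarrow> strongly_conn G \<or> bicycle G"
proof -
  interpret pair_fin_digraph G by fact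
  have wf: "pair_wf_digraph G" by unfold_locales
  have "atomic_poset (Path G) sublist \<longleftrightarrow> joint_embedding G"
    unfolding joint_embedding_def
    by (intro atomic_poset_iff_joint_embedding) (auto intro: sublist_order.order_trans)
  also have "\<dots> \<longleftrightarrow> strongly_conn G \<or> bicycle G"
    using strongly_conn_imp_joint_embedding joint_embedding_not_strongly_conn[OF wf]
      bottleneck_imp_joint_embedding[OF wf] bottleneck_imp_bicycle[OF wf pair_finite_verts]
      bicycle_imp_bottleneck[OF wf] by blast
  finally show ?thesis .
qed

end
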